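(* Let $\Sigma,U$ be real Hilbert spaces, let $a:\Sigma\times\Sigma\to\mathbb R$ be a bounded, symmetric, positive definite bilinear form, and let $b:\Sigma\times U\to\mathbb R$ be a bounded bilinear form satisfying the inf-sup condition $$0<\beta=\inf_{v\in U\setminus\{0\}}\sup_{\tau\in\Sigma\setminus\{0\}}\frac{b(\tau,v)}{\|\tau\|_\Sigma\|v\|_U}.$$ Assume that the space $U_0$ (defined in the context) is dense in $U$. Let $c,\ell:U\times U\to\mathbb R$ be symmetric, positive semidefinite, bounded bilinear forms such that the solution operator described in the context is compact. Let $\Sigma_h\subseteq\Sigma$ and $U_h\subseteq U$ be finite-dimensional subspaces satisfying the discrete inf-sup condition $$0<\beta_h=\inf_{v_h\in U_h\setminus\{0\}}\sup_{\tau_h\in\Sigma_h\setminus\{0\}}\frac{b(\tau_h,v_h)}{\|\tau_h\|_\Sigma\|v_h\|_U},$$ such that there is $v_h\in U_h$ with $\ell(v_h,v_h)>0$, and such that the inclusion of kernels $Z_h\subseteq Z$ holds, where $$Z=\{\tau\in\Sigma: b(\tau,v)=0\ \forall v\in U\},\qquad Z_h=\{\tau_h\in\Sigma_h: b(\tau_h,v_h)=0\ \forall v_h\in U_h\}.$$ Let $P_h:U\to U_h$ be a linear projection with $b(\tau_h,v-P_hv)=0$ for all $(\tau_h,v)\in\Sigma_h\times U$. Let $J$ be a positive integer such that there exist at least $J$ finite discrete eigenvalues $\lambda_{1,h}\le\dots\le\lambda_{J,h}$, let $\lambda_J$ be the $J$th eigenvalue of the continuous problem, and let $u_1,\dots,u_J$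 be $\ell$-orthonormal eigenfunctions corresponding to $\lambda_1\le\dots\le\lambda_J$ (all as in the context). Assume that there is a number $\delta_h$ such that every $u\in\operatorname{span}\{u_1,\dots,u_J\}$ satisfies $$\|u-P_hu\|_\ell^2\le\delta_h^2\,(\|Gu\|_a^2+\|u\|_c^2),$$ and that every $u\in\operatorname{span}\{u_1,\dots,u_J\}$ satisfies (i) $\|P_hu\|_\ell^2+\|u-P_hu\|_\ell^2=\|u\|_\ell^2$, (ii) $\|P_hu\|_c^2\le\|u\|_c^2$, (iii) $\mathcal A_h(P_hu,w_h)=0$ for all $w_h\in U_h$ with $\ell(w_h,w_h)=0$. Then $$\frac{\lambda_{J,h}}{1+\delta_h^2\lambda_{J,h}}\le\lambda_J .$$
   Context: Notation: $\|\cdot\|_a=a(\cdot,\cdot)^{1/2}$ (a norm on $\Sigma$, in general different from $\|\cdot\|_\Sigma$), $\|\cdot\|_c=c(\cdot,\cdot)^{1/2}$, $\|\cdot\|_\ell=\ell(\cdot,\cdot)^{1/2}$ (seminorms on $U$). $\overline\Sigma$ denotes the closure (completion) of $\Sigma$ with respect to $\|\cdot\|_a$, to which $a$ is extended by continuity. $U_0\subseteq U$ is the space of all $v\in U$ for which there exists a (then unique) $Gv\in\overline\Sigma$ with $$a(Gv,\tau)=-b(\tau,v)\quad\text{for all }\tau\in\Sigma.$$ For $v\in U$, $G_hv\in\Sigma_h$ is the unique solution to $a(G_hv,\tau_h)=-b(\tau_h,v)$ for all $\tau_h\in\Sigma_h$. Continuous eigenvalue problem: seek $(\lambda,u)\in\mathbb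 R\times U$ with $u\ne0$ such that, with $\sigma\in\Sigma$, $$a(\sigma,\tau)+b(\tau,u)=0\ \ \forall\tau\in\Sigma,\qquad b(\sigma,v)-c(u,v)=-\lambda\,\ell(u,v)\ \ \forall v\in U.$$ Here $\sigma=Gu$; equivalently, $u\in U_0$ and $\mathcal A(u,v)=\lambda\,\ell(u,v)$ for all $v\in U_0$, where $\mathcal A(u,v)=a(Gu,Gv)+c(u,v)$, which is an inner product on $U_0$. Compactness assumption: the solution operator mapping $f\in U$ to the solution $(\sigma,u)\in\Sigma\times U$ of $$a(\sigma,\tau)+b(\tau,u)=0\ \ \forall\tau\in\Sigma,\qquad b(\sigma,v)-c(u,v)=-\ell(f,v)\ \ \forall v\in U$$ (assumed to exist) is compact when the solution is measured in the norm $(\|u\|_U^2+\|\sigma\|_a^2)^{1/2}$. Consequently the finite eigenvalues have no finite accumulation point and are enumerated, counting multiplicity, as $0<\lambda_1\le\lambda_2\le\cdots$, with eigenfunctions $u_1,u_2,\dots$ that are $\ell$-orthonormal (and mutually $\mathcal A$-orthogonal). Discrete eigenvalue problem: seek $(\lambda_h,u_h)\in\mathbb R\times U_h$ with $\|u_h\|_\ell=1$ such that, with $\sigma_h\in\Sigma_h$, $$a(\sigma_h,\tau_h)+b(\tau_h,u_h)=0\ \ \forall\tau_h\in\Sigma_h,\qquad b(\sigma_h,v_h)-c(u_h,v_h)=-\lambda_h\,\ell(u_h,v_h)\ \ \forall v_h\in U_h;$$ equivalently $\mathcal A_h(u_h,v_h)=\lambda_h\ell(u_h,v_h)$ for all $v_h\in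 U_h$, where $\mathcal A_h(u_h,v_h)=a(G_hu_h,G_hv_h)+c(u_h,v_h)$, which is an inner product on $U_h$. The finite discrete eigenvalues are enumerated, counting multiplicity, as $0<\lambda_{1,h}\le\dots\le\lambda_{N,h}$. Under the inclusion of kernels, a projection $P_h$ with the stated property exists. *)

theory Defs
  imports "HOL-Analysis.Analysis"
begin

definition form_norm :: "('v \<Rightarrow> 'v \<Rightarrow> real) \<Rightarrow> 'v \<Rightarrow> real" where
  "form_norm q x = sqrt (q x x)"

definition symmetric_form :: "('v \<Rightarrow> 'v \<Rightarrow> real) \<Rightarrow> bool" where
  "symmetric_form q \<longleftrightarrow> (\<forall>x y. q x y = q y x)"

definition finite_dim_subspace :: "'v::real_vector set \<Rightarrow> bool" where
  "finite_dim_subspace V \<longleftrightarrow> subspace V \<and> (\<exists>B. finite B \<and> span B = V)"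

text \<open>
  Infimum and supremum are taken in the extended reals, so that both are meaningful without
  side conditions (the supremum over an empty set is \<open>-\<infinity>\<close>, the infimum over an empty set is \<open>\<infinity>\<close>).
\<close>
definition inf_sup_const ::
  "('s::real_normed_vector \<Rightarrow> 'u::real_normed_vector \<Rightarrow> real) \<Rightarrow> 's set \<Rightarrow> 'u set \<Rightarrow> ereal" where
  "inf_sup_const b S V =
     (INF v\<in>V - {0}. SUP \<tau>\<in>S - {0}. ereal (b \<tau> v / (norm \<tau> * norm v)))"

definition form_kernel :: "('s \<Rightarrow> 'u \<Rightarrow> real) \<Rightarrow> 's set \<Rightarrow> 'u set \<Rightarrow> 's set" where
  "form_kernel b S V = {\<tau>\<in>S. \<forall>v\<in>V. b \<tau> v = 0}"

text \<open>
  The completion of \<open>\<Sigma>\<close> (the type \<open>'s\<close>) with respect to the norm induced by \<open>a\<close> is represented by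
  a Hilbert space \<open>'h\<close> together with a linear map \<open>j\<close> that is isometric for \<open>a\<close> and has dense range;
  this determines \<open>('h, j)\<close> up to a unique isometric isomorphism.  The continuous extension of \<open>a\<close>
  to the completion is the inner product of \<open>'h\<close>, and its norm is the norm of \<open>'h\<close>.
\<close>
definition is_completion ::
  "('s::real_vector \<Rightarrow> 's \<Rightarrow> real) \<Rightarrow> ('s \<Rightarrow> 'h::{real_inner,complete_space}) \<Rightarrow> bool" where
  "is_completion a j \<longleftrightarrow>
     linear j \<and> (\<forall>\<sigma> \<tau>. inner (j \<sigma>) (j \<tau>) = a \<sigma> \<tau>) \<and> closure (range j) = UNIV"

definition represents ::
  "('s \<Rightarrow> 'u \<Rightarrow> real) \<Rightarrow> ('s \<Rightarrow> 'h::real_inner) \<Rightarrow> 'u \<Rightarrow> 'h \<Rightarrow> bool" where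
  "represents b j v g \<longleftrightarrow> (\<forall>\<tau>. inner g (j \<tau>) = - b \<tau> v)"

definition U0 :: "('s \<Rightarrow> 'u \<Rightarrow> real) \<Rightarrow> ('s \<Rightarrow> 'h::real_inner) \<Rightarrow> 'u set" where
  "U0 b j = {v. \<exists>g. represents b j v g}"

definition G :: "('s \<Rightarrow> 'u \<Rightarrow> real) \<Rightarrow> ('s \<Rightarrow> 'h::real_inner) \<Rightarrow> 'u \<Rightarrow> 'h" where
  "G b j v = (THE g. represents b j v g)"

definition Gh ::
  "('s \<Rightarrow> 's \<Rightarrow> real) \<Rightarrow> ('s \<Rightarrow> 'u \<Rightarrow> real) \<Rightarrow> 's set \<Rightarrow> 'u \<Rightarrow> 's" where
  "Gh a b Sh v = (THE \<sigma>. \<sigma> \<in> Sh \<and> (\<forall>\<tau>\<in>Sh. a \<sigma> \<tau> = - b \<tau> v))"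

definition Ah ::
  "('s \<Rightarrow> 's \<Rightarrow> real) \<Rightarrow> ('s \<Rightarrow> 'u \<Rightarrow> real) \<Rightarrow> ('u \<Rightarrow> 'u \<Rightarrow> real) \<Rightarrow> 's set \<Rightarrow> 'u \<Rightarrow> 'u \<Rightarrow> real" where
  "Ah a b c Sh u v = a (Gh a b Sh u) (Gh a b Sh v) + c u v"

definition source_solution ::
  "('s \<Rightarrow> 's \<Rightarrow> real) \<Rightarrow> ('s \<Rightarrow> 'u \<Rightarrow> real) \<Rightarrow> ('u \<Rightarrow> 'u \<Rightarrow> real) \<Rightarrow> ('u \<Rightarrow> 'u \<Rightarrow> real)
    \<Rightarrow> 'u \<Rightarrow> 's \<times> 'u \<Rightarrow> bool" where
  "source_solution a b c l f = (\<lambda>(\<sigma>, u).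
     (\<forall>\<tau>. a \<sigma> \<tau> + b \<tau> u = 0) \<and> (\<forall>v. b \<sigma> v - c u v = - l f v))"

definition solution_operator ::
  "('s \<Rightarrow> 's \<Rightarrow> real) \<Rightarrow> ('s \<Rightarrow> 'u \<Rightarrow> real) \<Rightarrow> ('u \<Rightarrow> 'u \<Rightarrow> real) \<Rightarrow> ('u \<Rightarrow> 'u \<Rightarrow> real)
    \<Rightarrow> 'u \<Rightarrow> 's \<times> 'u" where
  "solution_operator a b c l f = (THE p. source_solution a b c l f p)"

definition compact_operator :: "('x::real_normed_vector \<Rightarrow> 'y::real_normed_vector) \<Rightarrow> bool" where
  "compact_operator T \<longleftrightarrow> linear T \<and> (\<forall>B. bounded B \<longrightarrow> compact (closure (T ` B)))"

text \<open>
  Compactness refers to the solution measured in \<open>sqrt (\<parallel>u\<parallel>\<^sup>2 + \<parallel>\<sigma>\<parallel>\<^sub>a\<^sup>2)\<close>, which is the norm of the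
  product type \<open>'h \<times> 'u\<close> at \<open>(j \<sigma>, u)\<close>.  Closures are taken in the completion: \<open>\<Sigma>\<close> itself need not
  be complete for the norm induced by \<open>a\<close>.
\<close>
definition compact_solution_operator ::
  "('s \<Rightarrow> 's \<Rightarrow> real) \<Rightarrow> ('s \<Rightarrow> 'u::real_normed_vector \<Rightarrow> real) \<Rightarrow> ('u \<Rightarrow> 'u \<Rightarrow> real)
    \<Rightarrow> ('u \<Rightarrow> 'u \<Rightarrow> real) \<Rightarrow> ('s \<Rightarrow> 'h::real_normed_vector) \<Rightarrow> bool" where
  "compact_solution_operator a b c l j \<longleftrightarrow>
     (\<forall>f. \<exists>p. source_solution a b c l f p) \<and>
     compact_operator (\<lambda>f. map_prod j id (solution_operator a b c l f))"

definition eigen_equations ::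
  "('s \<Rightarrow> 's \<Rightarrow> real) \<Rightarrow> ('s \<Rightarrow> 'u \<Rightarrow> real) \<Rightarrow> ('u \<Rightarrow> 'u \<Rightarrow> real) \<Rightarrow> ('u \<Rightarrow> 'u \<Rightarrow> real)
    \<Rightarrow> 's set \<Rightarrow> 'u set \<Rightarrow> real \<Rightarrow> 's \<Rightarrow> 'u \<Rightarrow> bool" where
  "eigen_equations a b c l S V \<mu> \<sigma> u \<longleftrightarrow>
     (\<forall>\<tau>\<in>S. a \<sigma> \<tau> + b \<tau> u = 0) \<and> (\<forall>v\<in>V. b \<sigma> v - c u v = - \<mu> * l u v)"

definition eigenpair ::
  "('s \<Rightarrow> 's \<Rightarrow> real) \<Rightarrow> ('s \<Rightarrow> 'u::real_vector \<Rightarrow> real) \<Rightarrow> ('u \<Rightarrow> 'u \<Rightarrow> real)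
    \<Rightarrow> ('u \<Rightarrow> 'u \<Rightarrow> real) \<Rightarrow> real \<Rightarrow> 'u \<Rightarrow> bool" where
  "eigenpair a b c l \<mu> u \<longleftrightarrow> u \<noteq> 0 \<and> (\<exists>\<sigma>. eigen_equations a b c l UNIV UNIV \<mu> \<sigma> u)"

definition discrete_eigenpair ::
  "('s \<Rightarrow> 's \<Rightarrow> real) \<Rightarrow> ('s \<Rightarrow> 'u \<Rightarrow> real) \<Rightarrow> ('u \<Rightarrow> 'u \<Rightarrow> real) \<Rightarrow> ('u \<Rightarrow> 'u \<Rightarrow> real)
    \<Rightarrow> 's set \<Rightarrow> 'u set \<Rightarrow> real \<Rightarrow> 'u \<Rightarrow> bool" where
  "discrete_eigenpair a b c l Sh Uh \<mu> u \<longleftrightarrow>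
     u \<in> Uh \<and> form_norm l u = 1 \<and> (\<exists>\<sigma>\<in>Sh. eigen_equations a b c l Sh Uh \<mu> \<sigma> u)"

text \<open>
  \<open>lam 1 \<le> lam 2 \<le> \<dots>\<close>, with indices \<open>k \<ge> 1\<close> up to \<open>N\<close> (possibly \<open>\<infinity>\<close>), lists the real numbers
  \<open>\<mu>\<close> admitting some \<open>u\<close> with \<open>E \<mu> u\<close>, each repeated according to its multiplicity, which is the
  dimension of the span of these \<open>u\<close>.  Finiteness is required explicitly since \<open>card\<close> and \<open>dim\<close>
  are \<open>0\<close> in the infinite case.
\<close>
definition enumerates_eigenvalues ::
  "(real \<Rightarrow> 'u::real_vector \<Rightarrow> bool) \<Rightarrow> enat \<Rightarrow> (nat \<Rightarrow> real) \<Rightarrow> bool" where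
  "enumerates_eigenvalues E N lam \<longleftrightarrow>
     (\<forall>i k. 1 \<le> i \<and> i \<le> k \<and> enat k \<le> N \<longrightarrow> lam i \<le> lam k) \<and>
     (\<forall>\<mu>. (\<exists>B. finite B \<and> {u. E \<mu> u} \<subseteq> span B) \<and>
          finite {k. 1 \<le> k \<and> enat k \<le> N \<and> lam k = \<mu>} \<and>
          card {k. 1 \<le> k \<and> enat k \<le> N \<and> lam k = \<mu>} = dim {u. E \<mu> u})"

end

theory Submission
  imports Defs
begin

text \<open>
  For \<open>w\<close> in the span of \<open>u\<^sub>1, \<dots>, u\<^sub>J\<close>, the commutation property of \<open>P\<^sub>h\<close> makes \<open>G\<^sub>h P\<^sub>h w\<close> the
  \<open>a\<close>-orthogonal projection of \<open>G w\<close>, so \<open>P\<^sub>h\<close> does not increase the energy, while the hypotheses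
  bound the loss in the \<open>\<ell>\<close>-norm: \<open>\<parallel>P\<^sub>h w\<parallel>\<^sub>\<ell>\<^sup>2 \<ge> (1 - \<delta>\<^sub>h\<^sup>2 \<lambda>\<^sub>J) \<parallel>w\<parallel>\<^sub>\<ell>\<^sup>2\<close>. If \<open>\<delta>\<^sub>h\<^sup>2 \<lambda>\<^sub>J \<ge> 1\<close> the
  claim is trivial. Otherwise fewer than \<open>J\<close> linear conditions make \<open>P\<^sub>h w\<close> \<open>\<ell>\<close>-orthogonal to all
  discrete eigenvectors below \<open>\<lambda>\<^sub>J\<^sub>,\<^sub>h\<close> for some \<open>w \<noteq> 0\<close>. By (iii), \<open>P\<^sub>h w\<close> is also orthogonal to
  the kernel of \<open>\<ell>\<close>, so its discrete Rayleigh quotient is at least \<open>\<lambda>\<^sub>J\<^sub>,\<^sub>h\<close>.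
\<close>

section \<open>Bilinear forms: finite sums and null vectors\<close>

lemma bounded_bilinear_imp_bilinear: "bounded_bilinear q \<Longrightarrow> bilinear q"
  unfolding bilinear_def
  by (auto intro: bounded_linear.linear bounded_bilinear.bounded_linear_right
      bounded_bilinear.bounded_linear_left)

lemma bilinear_sum_scaleR_left:
  fixes q :: "'v::real_vector \<Rightarrow> 'w::real_vector \<Rightarrow> real"
  assumes "bilinear q"
  shows "q (\<Sum>i\<in>I. f i *\<^sub>R x i) y = (\<Sum>i\<in>I. f i * q (x i) y)"
proof -
  have "linear (\<lambda>x. q x y)"
    using assms by (simp add: bilinear_def)
  from linear_sum [OF this, of "\<lambda>i. f i *\<^sub>R x i" I] show ?thesis
    by (simp add: bilinear_lmul [OF assms])
qed

lemma bilinear_sum_scaleR_right: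
  fixes q :: "'v::real_vector \<Rightarrow> 'w::real_vector \<Rightarrow> real"
  assumes "bilinear q"
  shows "q y (\<Sum>i\<in>I. f i *\<^sub>R x i) = (\<Sum>i\<in>I. f i * q y (x i))"
proof -
  have "linear (q y)"
    using assms by (simp add: bilinear_def)
  from linear_sum [OF this, of "\<lambda>i. f i *\<^sub>R x i" I] show ?thesis
    by (simp add: bilinear_rmul [OF assms])
qed

text \<open>Since \<open>q x x = 0\<close>, the form at \<open>x + t *\<^sub>R z\<close> has no
  constant term in \<open>t\<close>; its linear term would make it negative for a small
  \<open>t\<close> of the right sign. Applied to \<open>A - \<mu> * l\<close>, this turns minimality
  into an eigenvalue equation.\<close>

lemma semidefinite_null_orthogonal:
  fixes q :: "'v::real_vector \<Rightarrow> 'v \<Rightarrow> real"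
  assumes q: "bilinear q" "symmetric_form q" and V: "subspace V"
    and psd: "\<And>v. v \<in> V \<Longrightarrow> 0 \<le> q v v"
    and x: "x \<in> V" "q x x = 0" and z: "z \<in> V"
  shows "q x z = 0"
proof (rule ccontr)
  assume nz: "q x z \<noteq> 0"
  define p where "p = q x z"
  define r where "r = q z z"
  have expand: "q (x + t *\<^sub>R z) (x + t *\<^sub>R z) = t * (2 * p + t * r)" for t
    using q x unfolding p_def r_def symmetric_form_def
    by (simp add: bilinear_ladd bilinear_radd bilinear_lmul bilinear_rmul algebra_simps)
  have nonneg: "0 \<le> t * (2 * p + t * r)" for t
    unfolding expand [symmetric] using V x z by (intro psd) (simp add: subspace_add subspace_scale)
  have "0 \<le> r"
    unfolding r_def using z by (rule psd)
  \<comment> \<open>The parameter is \<open>t = - p / (r + 1)\<close>; the summand 1 keeps the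
    denominator positive when \<open>r = 0\<close>.\<close>
  have "0 \<le> - p / (r + 1) * (2 * p + - p / (r + 1) * r)"
    by (rule nonneg)
  also have "\<dots> = - (p\<^sup>2 * (r + 2)) / (r + 1)\<^sup>2"
    using \<open>0 \<le> r\<close> by (simp add: divide_simps power2_eq_square) (simp add: algebra_simps)
  also have "\<dots> < 0"
    using \<open>0 \<le> r\<close> nz by (simp add: p_def divide_neg_pos)
  finally show False
    by simp
qed

section \<open>Orthonormal families for a bilinear form\<close>

definition orthonormal_for :: "('v \<Rightarrow> 'v \<Rightarrow> real) \<Rightarrow> 'v set \<Rightarrow> bool" where
  "orthonormal_for q C \<longleftrightarrow> (\<forall>x\<in>C. \<forall>y\<in>C. q x y = (if x = y then 1 else 0))"

lemma orthonormal_for_combination: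
  fixes q :: "'v::real_vector \<Rightarrow> 'v \<Rightarrow> real"
  assumes "bilinear q" "finite C" "orthonormal_for q C" "y \<in> C"
  shows "q (\<Sum>e\<in>C. f e *\<^sub>R e) y = f y"
proof -
  have "q (\<Sum>e\<in>C. f e *\<^sub>R e) y = (\<Sum>e\<in>C. f e * q e y)"
    using assms(1) by (rule bilinear_sum_scaleR_left)
  also have "\<dots> = (\<Sum>e\<in>C. if e = y then f e else 0)"
    using assms(3,4) by (intro sum.cong) (auto simp: orthonormal_for_def)
  finally show ?thesis
    using assms(2,4) by simp
qed

text \<open>Riesz representation on \<open>span C\<close>: both sides are linear in \<open>y\<close>
  and agree on \<open>C\<close>. With \<open>f = q x\<close> the sum is the orthogonal projection of
  \<open>x\<close>.\<close>

lemma orthonormal_for_represents: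
  fixes q :: "'v::real_vector \<Rightarrow> 'v \<Rightarrow> real"
  assumes q: "bilinear q" and C: "finite C" "orthonormal_for q C"
    and f: "linear f" and y: "y \<in> span C"
  shows "q (\<Sum>e\<in>C. f e *\<^sub>R e) y = f y"
proof (rule linear_eq_on_span [OF _ f _ y])
  show "linear (q (\<Sum>e\<in>C. f e *\<^sub>R e))"
    using q by (simp add: bilinear_def)
qed (use orthonormal_for_combination [OF q C] in blast)

text \<open>The sum represents \<open>q x\<close> on \<open>span C\<close>, so the remainder is
  orthogonal to itself and vanishes by definiteness.\<close>

lemma orthonormal_for_expansion:
  fixes q :: "'v::real_vector \<Rightarrow> 'v \<Rightarrow> real"
  assumes q: "bilinear q" "symmetric_form q" and C: "finite C" "orthonormal_for q C"
    and pos: "\<And>x. x \<in> span C \<Longrightarrow> x \<noteq> 0 \<Longrightarrow> 0 < q x x" and x: "x \<in> span C"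
  shows "x = (\<Sum>e\<in>C. q x e *\<^sub>R e)"
proof -
  let ?s = "\<Sum>e\<in>C. q x e *\<^sub>R e"
  have mem: "x - ?s \<in> span C"
    using x by (intro span_diff span_sum span_scale) (auto intro: span_base)
  have "linear (q x)"
    using q by (simp add: bilinear_def)
  then have "q ?s (x - ?s) = q x (x - ?s)"
    using orthonormal_for_represents [OF q(1) C _ mem] by blast
  then have "q (x - ?s) (x - ?s) = 0"
    by (simp add: bilinear_lsub [OF q(1)])
  then show ?thesis
    using pos [OF mem] by fastforce
qed

text \<open>Gram-Schmidt with respect to \<open>q\<close>. Positivity is asked on
  \<open>span B\<close> alone, so that \<open>q\<close> can be \<open>A\<close>, whose definiteness
  is established on \<open>Uh\<close>.\<close>

lemma orthonormal_basis_for_form: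
  fixes q :: "'v::real_vector \<Rightarrow> 'v \<Rightarrow> real"
  assumes q: "bilinear q" "symmetric_form q" and B: "finite B"
    and pos: "\<And>x. x \<in> span B \<Longrightarrow> x \<noteq> 0 \<Longrightarrow> 0 < q x x"
  obtains C where "finite C" "span C = span B" "orthonormal_for q C"
proof -
  have "\<exists>C. finite C \<and> span C = span B \<and> orthonormal_for q C"
    using B pos
  proof (induction B)
    case empty
    then show ?case
      by (intro exI [of _ "{}"]) (simp add: orthonormal_for_def)
  next
    case (insert b B)
    have "span B \<subseteq> span (insert b B)"
      by (intro span_mono) auto
    with insert obtain C where C: "finite C" "span C = span B" "orthonormal_for q C"
      by (meson subsetD)
    \<comment> \<open>\<open>s\<close> is the \<open>q\<close>-projection of \<open>b\<close> onto
      \<open>span C\<close>. The remainder \<open>r\<close> either vanishes, making \<open>b\<close>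
      redundant, or is normalized to the new basis vector.\<close>
    define s where "s = (\<Sum>e\<in>C. q b e *\<^sub>R e)"
    define r where "r = b - s"
    have s: "s \<in> span C"
      unfolding s_def by (intro span_sum span_scale span_base)
    have r: "r \<in> span (insert b B)"
      unfolding r_def using s C \<open>span B \<subseteq> _\<close> by (intro span_diff) (auto intro: span_base)
    have ortho: "q r e = 0" "q e r = 0" if "e \<in> C" for e
    proof -
      show "q r e = 0"
        using orthonormal_for_combination [OF q(1) C(1,3) that]
        by (simp add: r_def s_def bilinear_lsub [OF q(1)])
      then show "q e r = 0"
        using q(2) by (simp add: symmetric_form_def)
    qed
    show ?case
    proof (cases "r = 0")
      case True
      then have "b \<in> span B"
        using s C by (simp add: r_def)
      then show ?thesis
        using C span_redundant by metis
    next
      case False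
      define t where "t = 1 / sqrt (q r r)"
      define e where "e = t *\<^sub>R r"
      have "0 < q r r"
        using False insert.prems r by blast
      then have t: "t \<noteq> 0" "t * t * q r r = 1"
        by (auto simp: t_def field_simps)
      have qe: "q e e = 1" "\<And>x. x \<in> C \<Longrightarrow> q e x = 0" "\<And>x. x \<in> C \<Longrightarrow> q x e = 0"
        using t ortho by (simp_all add: e_def bilinear_lmul [OF q(1)] bilinear_rmul [OF q(1)])
      have sub: "span C \<subseteq> span (insert e C)"
        by (intro span_mono) auto
      have "r = (1 / t) *\<^sub>R e"
        using t by (simp add: e_def)
      moreover have "e \<in> span (insert e C)"
        by (simp add: span_base)
      ultimately have "r \<in> span (insert e C)"
        using span_scale by metis
      then have "r + s \<in> span (insert e C)"
        using s sub by (intro span_add) auto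
      then have "b \<in> span (insert e C)"
        by (simp add: r_def)
      moreover have "B \<subseteq> span (insert e C)"
        using span_superset [of B] C sub by auto
      ultimately have "span (insert b B) \<subseteq> span (insert e C)"
        by (intro span_minimal) auto
      moreover have "e \<in> span (insert b B)" "C \<subseteq> span (insert b B)"
        using r \<open>span B \<subseteq> _\<close> span_superset [of C] C by (auto simp: e_def span_scale)
      then have "span (insert e C) \<subseteq> span (insert b B)"
        by (intro span_minimal) auto
      moreover have "orthonormal_for q (insert e C)"
        using C(3) qe by (fastforce simp: orthonormal_for_def)
      ultimately show ?thesis
        using C(1) by (intro exI [of _ "insert e C"]) auto
    qed
  qed
  then show thesis
    using that by blast
qed

section \<open>Finite-dimensional subspaces: compactness, Rayleigh quotients, linear systems\<close>

lemma finite_dim_subspace_subset: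
  assumes V: "subspace V" "V \<subseteq> W" and W: "finite_dim_subspace W"
  shows "finite_dim_subspace V"
proof -
  obtain B where B: "finite B" "span B = W"
    using W by (auto simp: finite_dim_subspace_def)
  obtain D where D: "D \<subseteq> V" "independent D" "V \<subseteq> span D"
    using basis_exists [of V] by metis
  have "finite D"
    using independent_span_bound [OF B(1) D(2)] D(1) V B by auto
  moreover have "span D = V"
    using D V by (intro equalityI span_minimal)
  ultimately show ?thesis
    using V by (auto simp: finite_dim_subspace_def)
qed

text \<open>Each new vector \<open>e\<close> makes the set a continuous image of an interval times
  the previous compact set. The ambient space may be infinite-dimensional, so boundedness and
  closedness alone would not give compactness.\<close>

lemma compact_bounded_combinations:
  fixes C :: "'v::real_normed_vector set"
  assumes "finite C"
  shows "compact {\<Sum>e\<in>C. t e *\<^sub>R e |t. \<forall>e\<in>C. \<bar>t e\<bar> \<le> (1::real)}"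
  using assms
proof (induction C)
  case empty
  then show ?case by simp
next
  case (insert e C)
  let ?K = "\<lambda>C. {\<Sum>e\<in>C. t e *\<^sub>R e |t. \<forall>e\<in>C. \<bar>t e\<bar> \<le> (1::real)}"
  have "?K (insert e C) = (\<lambda>(s, x). s *\<^sub>R e + x) ` ({-1..1} \<times> ?K C)" (is "?L = ?R")
  proof (intro equalityI subsetI)
    fix y assume "y \<in> ?L"
    then obtain t where t: "y = (\<Sum>e\<in>insert e C. t e *\<^sub>R e)" "\<forall>e\<in>insert e C. \<bar>t e\<bar> \<le> 1"
      by blast
    then have "y = t e *\<^sub>R e + (\<Sum>e\<in>C. t e *\<^sub>R e)"
      using insert by simp
    moreover have "(\<Sum>e\<in>C. t e *\<^sub>R e) \<in> ?K C" "t e \<in> {-1..1}"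
      using t by auto
    ultimately show "y \<in> ?R"
      by (intro image_eqI [of _ _ "(t e, \<Sum>e\<in>C. t e *\<^sub>R e)"]) auto
  next
    fix y assume "y \<in> ?R"
    then obtain s t where t: "y = s *\<^sub>R e + (\<Sum>e\<in>C. t e *\<^sub>R e)" "\<bar>s\<bar> \<le> 1" "\<forall>e\<in>C. \<bar>t e\<bar> \<le> 1"
      by auto
    have "(\<Sum>x\<in>C. (t(e := s)) x *\<^sub>R x) = (\<Sum>x\<in>C. t x *\<^sub>R x)"
      using insert by (intro sum.cong) auto
    then have "y = (\<Sum>x\<in>insert e C. (t(e := s)) x *\<^sub>R x)"
      using insert t by simp
    then show "y \<in> ?L"
      using t by (intro CollectI exI [of _ "t(e := s)"]) auto
  qed
  moreover have "compact ?R"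
    using insert by (intro compact_continuous_image compact_Times)
      (auto intro!: continuous_intros simp: case_prod_unfold)
  ultimately show ?case
    by simp
qed

text \<open>By Cauchy-Schwarz, the coefficients of a unit vector in an orthonormal basis are at most
  1 in modulus, so the sphere is a closed part of a compact set of combinations.\<close>

lemma compact_unit_sphere_finite_dim:
  fixes V :: "'v::real_inner set"
  assumes "finite_dim_subspace V"
  shows "compact {v \<in> V. norm v = 1}"
proof -
  obtain B where B: "finite B" "span B = V"
    using assms by (auto simp: finite_dim_subspace_def)
  have q: "bilinear (inner :: 'v \<Rightarrow> 'v \<Rightarrow> real)" "symmetric_form (inner :: 'v \<Rightarrow> 'v \<Rightarrow> real)"
    using bounded_bilinear_imp_bilinear [OF bounded_bilinear_inner]
    by (auto simp: symmetric_form_def inner_commute)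
  obtain C where C: "finite C" "span C = span B" "orthonormal_for inner C"
    using orthonormal_basis_for_form [OF q B(1)] by auto
  let ?K = "{\<Sum>e\<in>C. t e *\<^sub>R e |t. \<forall>e\<in>C. \<bar>t e\<bar> \<le> (1::real)}"
  have "{v \<in> V. norm v = 1} = ?K \<inter> sphere 0 1"
  proof (intro equalityI subsetI)
    fix v assume v: "v \<in> {v \<in> V. norm v = 1}"
    then have "v = (\<Sum>e\<in>C. inner v e *\<^sub>R e)"
      using C B by (intro orthonormal_for_expansion [OF q C(1,3)]) auto
    moreover have "\<bar>inner v e\<bar> \<le> 1" if "e \<in> C" for e
    proof -
      have "norm e = 1"
        using C(3) that by (simp add: orthonormal_for_def norm_eq_sqrt_inner)
      then show ?thesis
        using Cauchy_Schwarz_ineq2 [of v e] v by simp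
    qed
    ultimately show "v \<in> ?K \<inter> sphere 0 1"
      using v by auto
  next
    fix v assume v: "v \<in> ?K \<inter> sphere 0 1"
    then have "v \<in> span C"
      by (auto intro: span_sum span_scale span_base)
    then show "v \<in> {v \<in> V. norm v = 1}"
      using v C B by auto
  qed
  moreover have "closed (sphere (0::'v) 1)"
    unfolding sphere_def by (intro closed_Collect_eq continuous_intros)
  ultimately show ?thesis
    using compact_bounded_combinations [OF C(1)] by (simp only: compact_Int_closed)
qed

lemma rayleigh_minimizer:
  fixes A l :: "'v::real_inner \<Rightarrow> 'v \<Rightarrow> real"
  assumes A: "bounded_bilinear A" "symmetric_form A" and l: "bounded_bilinear l" "symmetric_form l"
    and V: "finite_dim_subspace V" "V \<noteq> {0}"
    and pos: "\<And>v. v \<in> V \<Longrightarrow> v \<noteq> 0 \<Longrightarrow> 0 < l v v"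
  obtains v \<mu> where "v \<in> V" "v \<noteq> 0" "\<And>z. z \<in> V \<Longrightarrow> A v z = \<mu> * l v z"
    "\<And>z. z \<in> V \<Longrightarrow> \<mu> * l z z \<le> A z z"
proof -
  let ?S = "{v \<in> V. norm v = 1}"
  have sub: "subspace V"
    using V by (simp add: finite_dim_subspace_def)
  have normalize: "(1 / norm v) *\<^sub>R v \<in> ?S" if "v \<in> V" "v \<noteq> 0" for v
    using that sub by (auto intro: subspace_scale)
  have "?S \<noteq> {}"
    using normalize V sub subspace_0 by blast
  moreover have "continuous_on ?S (\<lambda>v. A v v / l v v)"
    using pos by (intro continuous_intros bounded_bilinear.continuous_on [OF A(1)]
        bounded_bilinear.continuous_on [OF l(1)]) force
  ultimately obtain v where v: "v \<in> ?S" "\<And>z. z \<in> ?S \<Longrightarrow> A v v / l v v \<le> A z z / l z z"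
    using continuous_attains_inf [OF compact_unit_sphere_finite_dim [OF V(1)]] by blast
  define \<mu> where "\<mu> = A v v / l v v"
  note bil = bounded_bilinear_imp_bilinear [OF A(1)] bounded_bilinear_imp_bilinear [OF l(1)]
  have low: "\<mu> * l z z \<le> A z z" if z: "z \<in> V" for z
  proof (cases "z = 0")
    case True
    then show ?thesis
      using bil by (simp add: bilinear_lzero)
  next
    case False
    have "\<mu> \<le> A ((1 / norm z) *\<^sub>R z) ((1 / norm z) *\<^sub>R z) / l ((1 / norm z) *\<^sub>R z) ((1 / norm z) *\<^sub>R z)"
      unfolding \<mu>_def using normalize [OF z False] by (rule v)
    also have "\<dots> = A z z / l z z"
      using bil False by (simp add: bilinear_lmul bilinear_rmul)
    finally show ?thesis
      using pos [OF z False] by (simp add: field_simps)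
  qed
  have v': "v \<in> V" "v \<noteq> 0"
    using v(1) by auto
  define q where "q = (\<lambda>x y. A x y - \<mu> * l x y)"
  have "bilinear q"
    using bil unfolding q_def bilinear_def linear_iff by (simp add: algebra_simps)
  moreover have "symmetric_form q"
    using A(2) l(2) by (simp add: q_def symmetric_form_def)
  moreover have "q v v = 0"
    using pos [OF v'] by (simp add: q_def \<mu>_def)
  ultimately have "q v z = 0" if "z \<in> V" for z
    using semidefinite_null_orthogonal [of q V v z] sub low v' that by (simp add: q_def)
  then show thesis
    using that [OF v', of \<mu>] low by (simp add: q_def)
qed

text \<open>Gaussian elimination: equation \<open>d\<close> is solved for a pivot unknown
  \<open>p\<close>, which leaves one equation and one unknown fewer.\<close>

lemma homogeneous_system_nontrivial:
  fixes f :: "'d \<Rightarrow> 'k \<Rightarrow> real"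
  assumes "finite D" "finite I" "card D < card I"
  shows "\<exists>\<alpha>. (\<exists>k\<in>I. \<alpha> k \<noteq> 0) \<and> (\<forall>d\<in>D. (\<Sum>k\<in>I. \<alpha> k * f d k) = 0)"
  using assms
proof (induction D arbitrary: I f)
  case empty
  then obtain k where "k \<in> I"
    by fastforce
  then show ?case
    by (intro exI [of _ "\<lambda>_. 1"]) auto
next
  case (insert d D)
  show ?case
  proof (cases "\<forall>k\<in>I. f d k = 0")
    case True
    obtain \<alpha> where "\<exists>k\<in>I. \<alpha> k \<noteq> 0" "\<forall>d\<in>D. (\<Sum>k\<in>I. \<alpha> k * f d k) = 0"
      using insert.IH [of I f] insert.prems insert.hyps by auto
    then show ?thesis
      using True by (intro exI [of _ \<alpha>]) auto
  next
    case False
    then obtain p where p: "p \<in> I" "f d p \<noteq> 0"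
      by blast
    define I' where "I' = I - {p}"
    have I: "I = insert p I'" "p \<notin> I'" "finite I'" "card D < card I'"
      using p insert.prems insert.hyps by (auto simp: I'_def)
    obtain \<alpha> where \<alpha>: "\<exists>k\<in>I'. \<alpha> k \<noteq> 0"
      "\<forall>e\<in>D. (\<Sum>k\<in>I'. \<alpha> k * (f e k - f d k / f d p * f e p)) = 0"
      using insert.IH [OF I(3,4), of "\<lambda>e k. f e k - f d k / f d p * f e p"] by blast
    \<comment> \<open>Back substitution: the value at \<open>p\<close> is the one that equation
      \<open>d\<close> forces.\<close>
    define \<beta> where "\<beta> = \<alpha>(p := - (\<Sum>k\<in>I'. \<alpha> k * f d k) / f d p)"
    have sum: "(\<Sum>k\<in>I. \<beta> k * f e k) = \<beta> p * f e p + (\<Sum>k\<in>I'. \<alpha> k * f e k)" for e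
    proof -
      have "(\<Sum>k\<in>I'. \<beta> k * f e k) = (\<Sum>k\<in>I'. \<alpha> k * f e k)"
        using I by (intro sum.cong) (auto simp: \<beta>_def)
      then show ?thesis
        using I by simp
    qed
    have "(\<Sum>k\<in>I. \<beta> k * f e k) = 0" if "e \<in> D" for e
    proof -
      have "(\<Sum>k\<in>I'. \<alpha> k * f e k) - (\<Sum>k\<in>I'. \<alpha> k * f d k) * (f e p / f d p) = 0"
        using \<alpha>(2) that
        by (simp add: algebra_simps sum_subtractf sum_distrib_left sum_distrib_right)
      then show ?thesis
        unfolding sum by (simp add: \<beta>_def)
    qed
    moreover have "(\<Sum>k\<in>I. \<beta> k * f d k) = 0"
      unfolding sum using p by (simp add: \<beta>_def)
    moreover have "\<exists>k\<in>I. \<beta> k \<noteq> 0"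
      using \<alpha>(1) I by (auto simp: \<beta>_def)
    ultimately show ?thesis
      by (intro exI [of _ \<beta>]) auto
  qed
qed

section \<open>The inf-sup condition and eigenvalues counted with multiplicity\<close>

lemma inf_sup_const_nondegenerate:
  assumes "0 < inf_sup_const b S V" "v \<in> V" "v \<noteq> 0"
  obtains \<tau> where "\<tau> \<in> S" "b \<tau> v \<noteq> 0"
proof -
  have "inf_sup_const b S V \<le> (SUP \<tau>\<in>S - {0}. ereal (b \<tau> v / (norm \<tau> * norm v)))"
    unfolding inf_sup_const_def using assms(2,3) by (intro INF_lower) auto
  with assms(1) have "0 < (SUP \<tau>\<in>S - {0}. ereal (b \<tau> v / (norm \<tau> * norm v)))"
    by (rule less_le_trans)
  then obtain \<tau> where "\<tau> \<in> S" "0 < b \<tau> v / (norm \<tau> * norm v)"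
    by (auto simp: less_SUP_iff)
  then show thesis
    using that by fastforce
qed

lemma form_norm_power2: "0 \<le> q x x \<Longrightarrow> (form_norm q x)\<^sup>2 = q x x"
  by (simp add: form_norm_def)

lemma enumerates_eigenvalues_mono:
  assumes "enumerates_eigenvalues E N lam" "1 \<le> i" "i \<le> k" "enat k \<le> N"
  shows "lam i \<le> lam k"
  using assms unfolding enumerates_eigenvalues_def by blast

text \<open>The basis is picked among the eigenvectors themselves. These form no subspace in the
  applications, where zero is excluded, so \<open>span B\<close> merely contains them.\<close>

lemma enumerates_eigenvalues_eigenbasis:
  assumes "enumerates_eigenvalues E N lam"
  obtains B where "finite B" "B \<subseteq> {u. E \<mu> u}" "{u. E \<mu> u} \<subseteq> span B"
    "card B = card {k. 1 \<le> k \<and> enat k \<le> N \<and> lam k = \<mu>}"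
proof -
  obtain D where D: "finite D" "{u. E \<mu> u} \<subseteq> span D"
    and card: "card {k. 1 \<le> k \<and> enat k \<le> N \<and> lam k = \<mu>} = dim {u. E \<mu> u}"
    using assms unfolding enumerates_eigenvalues_def by metis
  obtain B where B: "B \<subseteq> {u. E \<mu> u}" "independent B" "{u. E \<mu> u} \<subseteq> span B"
    "card B = dim {u. E \<mu> u}"
    using basis_exists by blast
  have "finite B"
    using independent_span_bound [OF D(1) B(2)] B(1) D(2) by auto
  then show thesis
    using that B card by simp
qed

text \<open>\<open>D\<close> joins bases for all eigenvalues strictly below \<open>lam J\<close>.
  Its size is at most the number of indices carrying such values, and by monotonicity all of these
  indices are less than \<open>J\<close>. Orthogonality to \<open>D\<close> thus costs fewer than
  \<open>J\<close> linear conditions.\<close>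

lemma enumerates_eigenvalues_lower_span:
  assumes enum: "enumerates_eigenvalues E N lam" and J: "1 \<le> J" "enat J \<le> N"
    and nz: "\<And>\<mu> u. E \<mu> u \<Longrightarrow> u \<noteq> 0"
  obtains D where "finite D" "card D < J" "\<And>d. d \<in> D \<Longrightarrow> \<exists>\<mu>. E \<mu> d"
    "\<And>\<mu> u. E \<mu> u \<Longrightarrow> \<mu> < lam J \<Longrightarrow> u \<in> span D"
proof -
  define I where "I \<mu> = {k. 1 \<le> k \<and> enat k \<le> N \<and> lam k = \<mu>}" for \<mu>
  have finI: "finite (I \<mu>)" for \<mu>
    using enum unfolding enumerates_eigenvalues_def I_def by blast
  have "\<exists>B. finite B \<and> B \<subseteq> {u. E \<mu> u} \<and> {u. E \<mu> u} \<subseteq> span B \<and> card B = card (I \<mu>)" for \<mu>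
    using enumerates_eigenvalues_eigenbasis [OF enum, of \<mu>] unfolding I_def by metis
  then obtain B where B: "\<And>\<mu>. finite (B \<mu>)" "\<And>\<mu>. B \<mu> \<subseteq> {u. E \<mu> u}"
    "\<And>\<mu>. {u. E \<mu> u} \<subseteq> span (B \<mu>)" "\<And>\<mu>. card (B \<mu>) = card (I \<mu>)"
    by metis
  \<comment> \<open>Indices before \<open>J\<close> whose value ties with \<open>lam J\<close> are
    dropped, so \<open>D\<close> may have fewer than \<open>J - 1\<close> elements.\<close>
  define L where "L = {\<mu> \<in> lam ` {1..<J}. \<mu> < lam J}"
  have finL: "finite L"
    by (simp add: L_def)
  define D where "D = (\<Union>\<mu>\<in>L. B \<mu>)"
  have below: "k < J" if "1 \<le> k" "enat k \<le> N" "lam k < lam J" for k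
    using enumerates_eigenvalues_mono [OF enum J(1), of k] that by (meson leD leI)
  have "card D \<le> (\<Sum>\<mu>\<in>L. card (B \<mu>))"
    unfolding D_def using finL by (rule card_UN_le)
  also have "\<dots> = card (\<Union>\<mu>\<in>L. I \<mu>)"
    unfolding B(4) using finL finI by (intro card_UN_disjoint [symmetric]) (auto simp: I_def)
  also have "\<dots> \<le> card {1..<J}"
    using below by (intro card_mono) (auto simp: I_def L_def)
  finally have "card D < J"
    using J(1) by simp
  moreover have "u \<in> span D" if E: "E \<mu> u" and "\<mu> < lam J" for \<mu> u
  proof -
    have u: "u \<in> span (B \<mu>)"
      using B(3) E by blast
    \<comment> \<open>A nonzero eigenvector makes the multiplicity positive, so \<open>\<mu>\<close>
      occurs in the enumeration, and necessarily at an index below \<open>J\<close>.\<close>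
    have "B \<mu> \<noteq> {}"
      using u nz [OF E] by auto
    then have "I \<mu> \<noteq> {}"
      using B(1,4) [of \<mu>] by auto
    then have "\<mu> \<in> L"
      using below \<open>\<mu> < lam J\<close> by (auto simp: I_def L_def)
    then show ?thesis
      using u span_mono [of "B \<mu>" D] by (auto simp: D_def)
  qed
  moreover have "finite D" "\<And>d. d \<in> D \<Longrightarrow> \<exists>\<mu>. E \<mu> d"
    using finL B(1,2) by (auto simp: D_def)
  ultimately show thesis
    using that by blast
qed

text \<open>The index \<open>J\<close> itself shows that the multiplicity of \<open>lam J\<close> is
  positive.\<close>

lemma enumerates_eigenvalues_eigenvector:
  assumes "enumerates_eigenvalues E N lam" "1 \<le> J" "enat J \<le> N"
  obtains u where "E (lam J) u"
proof -
  obtain B where B: "finite B" "B \<subseteq> {u. E (lam J) u}"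
    "card B = card {k. 1 \<le> k \<and> enat k \<le> N \<and> lam k = lam J}"
    using enumerates_eigenvalues_eigenbasis [OF assms(1), of "lam J"] by metis
  have "finite {k. 1 \<le> k \<and> enat k \<le> N \<and> lam k = lam J}"
    using assms(1) unfolding enumerates_eigenvalues_def by blast
  then have "card B \<noteq> 0"
    using assms(2,3) B(3) by auto
  then obtain u where "u \<in> B"
    by fastforce
  then show thesis
    using that B(2) by blast
qed

section \<open>The discrete problem: the operator \<open>gh\<close>, the form \<open>A\<close> and
  its Rayleigh quotient\<close>

locale discrete_problem =
  fixes a :: "'s::real_normed_vector \<Rightarrow> 's \<Rightarrow> real"
    and b :: "'s \<Rightarrow> 'u::real_inner \<Rightarrow> real"
    and c l :: "'u \<Rightarrow> 'u \<Rightarrow> real"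
    and Sh :: "'s set" and Uh :: "'u set"
  assumes a: "bounded_bilinear a" "symmetric_form a" "\<And>\<sigma>. \<sigma> \<noteq> 0 \<Longrightarrow> 0 < a \<sigma> \<sigma>"
    and b: "bounded_bilinear b"
    and c: "bounded_bilinear c" "symmetric_form c" "\<And>v. 0 \<le> c v v"
    and l: "bounded_bilinear l" "symmetric_form l" "\<And>v. 0 \<le> l v v"
    and Sh: "finite_dim_subspace Sh" and Uh: "finite_dim_subspace Uh"
    and inf_sup: "0 < inf_sup_const b Sh Uh"
begin

abbreviation "gh \<equiv> Gh a b Sh"
abbreviation "A \<equiv> Ah a b c Sh"

lemmas a_bil = bounded_bilinear_imp_bilinear [OF a(1)]
lemmas b_bil = bounded_bilinear_imp_bilinear [OF b]
lemmas c_bil = bounded_bilinear_imp_bilinear [OF c(1)]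
lemmas l_bil = bounded_bilinear_imp_bilinear [OF l(1)]

lemma a_nonneg: "0 \<le> a \<sigma> \<sigma>"
  using a(3) [of \<sigma>] bilinear_lzero [OF a_bil] by (cases "\<sigma> = 0") auto

lemma subspace_Sh: "subspace Sh" and subspace_Uh: "subspace Uh"
  using Sh Uh by (auto simp: finite_dim_subspace_def)

lemma Gh_unique:
  assumes "\<sigma> \<in> Sh" "\<And>\<tau>. \<tau> \<in> Sh \<Longrightarrow> a \<sigma> \<tau> = - b \<tau> v"
    and "\<sigma>' \<in> Sh" "\<And>\<tau>. \<tau> \<in> Sh \<Longrightarrow> a \<sigma>' \<tau> = - b \<tau> v"
  shows "\<sigma> = \<sigma>'"
proof -
  have "\<sigma> - \<sigma>' \<in> Sh"
    using assms subspace_Sh by (auto intro: subspace_diff)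
  then have "a (\<sigma> - \<sigma>') (\<sigma> - \<sigma>') = 0"
    using assms by (simp add: bilinear_lsub [OF a_bil])
  then show ?thesis
    using a(3) [of "\<sigma> - \<sigma>'"] by auto
qed

lemma Gh_eqI:
  assumes "\<sigma> \<in> Sh" "\<And>\<tau>. \<tau> \<in> Sh \<Longrightarrow> a \<sigma> \<tau> = - b \<tau> v"
  shows "gh v = \<sigma>"
  unfolding Gh_def using assms Gh_unique by (intro the_equality) blast+

text \<open>Riesz representation of \<open>- b \<tau> v\<close> in an \<open>a\<close>-orthonormal
  basis of \<open>Sh\<close>. The explicit finite sum also exhibits \<open>gh\<close> as bounded and
  linear.\<close>

lemma Gh_expansion:
  obtains C where "finite C" "\<And>v. gh v = (\<Sum>e\<in>C. (- b e v) *\<^sub>R e)"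
    "\<And>v. gh v \<in> Sh" "\<And>v \<tau>. \<tau> \<in> Sh \<Longrightarrow> a (gh v) \<tau> = - b \<tau> v"
proof -
  obtain B where B: "finite B" "span B = Sh"
    using Sh by (auto simp: finite_dim_subspace_def)
  obtain C where C: "finite C" "span C = Sh" "orthonormal_for a C"
    using orthonormal_basis_for_form [OF a_bil a(2) B(1)] a(3) B by metis
  have *: "a (\<Sum>e\<in>C. (- b e v) *\<^sub>R e) \<tau> = - b \<tau> v" if "\<tau> \<in> Sh" for v \<tau>
  proof (rule orthonormal_for_represents [OF a_bil C(1,3)])
    show "linear (\<lambda>\<tau>. - b \<tau> v)"
      using b_bil by (simp add: bilinear_def linear_compose_neg)
  qed (use that C in simp)
  have mem: "(\<Sum>e\<in>C. (- b e v) *\<^sub>R e) \<in> Sh" for v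
    unfolding C(2) [symmetric] by (intro span_sum span_scale span_base)
  have gh: "gh v = (\<Sum>e\<in>C. (- b e v) *\<^sub>R e)" for v
    by (rule Gh_eqI [OF mem *])
  show thesis
    by (rule that [OF C(1)]) (use gh mem * in simp_all)
qed

lemma Gh_mem: "gh v \<in> Sh"
  using Gh_expansion by metis

lemma Gh_eq: "\<tau> \<in> Sh \<Longrightarrow> a (gh v) \<tau> = - b \<tau> v"
  using Gh_expansion by metis

lemma bounded_linear_Gh: "bounded_linear gh"
proof -
  obtain C where C: "\<And>v. gh v = (\<Sum>e\<in>C. (- b e v) *\<^sub>R e)"
    using Gh_expansion by metis
  have "bounded_linear (\<lambda>v. \<Sum>e\<in>C. (- b e v) *\<^sub>R e)"
    using b by (intro bounded_linear_sum bounded_linear_scaleR_const bounded_linear_minus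
        bounded_bilinear.bounded_linear_right)
  then show ?thesis
    by (simp add: C [abs_def])
qed

text \<open>Boundedness provides the continuity needed to minimize the Rayleigh quotient of
  \<open>A\<close>.\<close>

lemma bounded_bilinear_Ah: "bounded_bilinear A"
proof -
  interpret a: bounded_bilinear a by (rule a)
  interpret c: bounded_bilinear c by (rule c)
  interpret g: bounded_linear gh by (rule bounded_linear_Gh)
  interpret ag: bounded_bilinear "\<lambda>u v. a (gh u) (gh v)"
    by (rule a.comp [OF bounded_linear_Gh bounded_linear_Gh])
  obtain K where K: "\<And>u v. norm (a (gh u) (gh v)) \<le> norm u * norm v * K"
    using ag.bounded by blast
  obtain M where M: "\<And>u v. norm (c u v) \<le> norm u * norm v * M"
    using c.bounded by blast
  show ?thesis
    unfolding Ah_def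
  proof
    show "\<exists>K. \<forall>u v. norm (a (gh u) (gh v) + c u v) \<le> norm u * norm v * K"
      using norm_triangle_mono [OF K M] by (intro exI [of _ "K + M"]) (simp add: distrib_left)
  qed (simp_all add: ag.add_left ag.add_right ag.scaleR_left ag.scaleR_right c.add_left c.add_right
      c.scaleR_left c.scaleR_right algebra_simps)
qed

lemmas A_bil = bounded_bilinear_imp_bilinear [OF bounded_bilinear_Ah]

lemma symmetric_Ah: "symmetric_form A"
  using a(2) c(2) by (simp add: symmetric_form_def Ah_def)

text \<open>The discrete inf-sup condition makes \<open>gh v\<close> nonzero for nonzero
  \<open>v\<close> in \<open>Uh\<close>.\<close>

lemma Ah_pos:
  assumes "v \<in> Uh" "v \<noteq> 0"
  shows "0 < A v v"
proof -
  obtain \<tau> where \<tau>: "\<tau> \<in> Sh" "b \<tau> v \<noteq> 0"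
    using inf_sup_const_nondegenerate [OF inf_sup assms] .
  then have "a (gh v) \<tau> \<noteq> 0"
    by (simp add: Gh_eq)
  then have "gh v \<noteq> 0"
    using bilinear_lzero [OF a_bil] by auto
  then show ?thesis
    using a(3) c(3) [of v] by (fastforce simp: Ah_def)
qed

text \<open>The first equation forces \<open>\<sigma> = gh u\<close>. Testing the definition of
  \<open>gh v\<close> with \<open>gh u\<close> turns \<open>b (gh u) v\<close> into
  \<open>- a (gh u) (gh v)\<close>, which eliminates \<open>\<sigma>\<close>.\<close>

lemma discrete_eigenpair_iff:
  "discrete_eigenpair a b c l Sh Uh \<mu> u \<longleftrightarrow>
     u \<in> Uh \<and> l u u = 1 \<and> (\<forall>v\<in>Uh. A u v = \<mu> * l u v)"
proof -
  have *: "b (gh u) v = - a (gh u) (gh v)" for v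
    using Gh_eq [OF Gh_mem, of v u] a(2) by (simp add: symmetric_form_def)
  have "(\<exists>\<sigma>\<in>Sh. eigen_equations a b c l Sh Uh \<mu> \<sigma> u) \<longleftrightarrow>
      eigen_equations a b c l Sh Uh \<mu> (gh u) u"
  proof
    assume "\<exists>\<sigma>\<in>Sh. eigen_equations a b c l Sh Uh \<mu> \<sigma> u"
    then obtain \<sigma> where \<sigma>: "\<sigma> \<in> Sh" "eigen_equations a b c l Sh Uh \<mu> \<sigma> u"
      by blast
    have "gh u = \<sigma>"
      using \<sigma> by (intro Gh_eqI) (auto simp: eigen_equations_def eq_neg_iff_add_eq_0)
    then show "eigen_equations a b c l Sh Uh \<mu> (gh u) u"
      using \<sigma> by simp
  qed (use Gh_mem in blast)
  also have "\<dots> \<longleftrightarrow> (\<forall>v\<in>Uh. A u v = \<mu> * l u v)"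
    by (auto simp: eigen_equations_def Gh_eq * Ah_def)
  finally show ?thesis
    using l(3) [of u] by (simp add: discrete_eigenpair_def form_norm_def)
qed

lemma discrete_eigenvalue_pos:
  assumes "discrete_eigenpair a b c l Sh Uh \<mu> u"
  shows "0 < \<mu>"
proof -
  have u: "u \<in> Uh" "l u u = 1" "A u u = \<mu>"
    using assms by (auto simp: discrete_eigenpair_iff)
  then have "u \<noteq> 0"
    using bilinear_lzero [OF l_bil] by auto
  then show ?thesis
    using Ah_pos u by metis
qed

lemma l_null_orthogonal: "k \<in> Uh \<Longrightarrow> l k k = 0 \<Longrightarrow> v \<in> Uh \<Longrightarrow> l v k = 0"
  using semidefinite_null_orthogonal [OF l_bil l(2) subspace_Uh, of k v] l(2,3)
  by (auto simp: symmetric_form_def)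

text \<open>
  A minimizer of the Rayleigh quotient over the \<open>A\<close>-orthogonal complement of the given
  eigenvectors and of the kernel of \<open>l\<close> is again a discrete eigenvector, so its eigenvalue cannot
  be smaller than \<open>\<Lambda>\<close>.
\<close>
lemma discrete_rayleigh_lower_bound:
  assumes D: "\<And>d. d \<in> D \<Longrightarrow> \<exists>\<mu>. discrete_eigenpair a b c l Sh Uh \<mu> d"
    and low: "\<And>\<mu> u. discrete_eigenpair a b c l Sh Uh \<mu> u \<Longrightarrow> \<mu> < \<Lambda> \<Longrightarrow> u \<in> span D"
    and w: "w \<in> Uh" "\<And>d. d \<in> D \<Longrightarrow> l w d = 0" "\<And>k. k \<in> Uh \<Longrightarrow> l k k = 0 \<Longrightarrow> A w k = 0"
  shows "\<Lambda> * l w w \<le> A w w"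
proof (cases "w = 0")
  case True
  then show ?thesis
    using bilinear_lzero [OF l_bil] bilinear_lzero [OF A_bil] by simp
next
  case False
  \<comment> \<open>\<open>K\<close> collects the vectors of \<open>Uh\<close> on which the
    denominator of the Rayleigh quotient vanishes. \<open>V\<close> is the
    \<open>A\<close>-orthogonal complement in \<open>Uh\<close> of \<open>K\<close> and the given
    eigenvectors.\<close>
  define K where "K = {k \<in> Uh. l k k = 0}"
  define M where "M = span (D \<union> K)"
  define V where "V = {v \<in> Uh. \<forall>m\<in>M. A v m = 0}"
  have DK: "D \<union> K \<subseteq> Uh"
    using D by (auto simp: K_def discrete_eigenpair_iff)
  then have MU: "M \<subseteq> Uh"
    unfolding M_def using subspace_Uh by (rule span_minimal)
  have null_on_M: "q v m = 0"
    if "bilinear q" "\<And>m. m \<in> D \<union> K \<Longrightarrow> q v m = 0" "m \<in> M" for q :: "'u \<Rightarrow> 'u \<Rightarrow> real" and v m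
    using linear_eq_0_on_span [of "q v" "D \<union> K" m] that by (auto simp: M_def bilinear_def)
  \<comment> \<open>Positivity of the eigenvalue makes \<open>A\<close>- and
    \<open>l\<close>-orthogonality to \<open>d\<close> equivalent; this puts \<open>w\<close> into
    \<open>V\<close>.\<close>
  have eig: "A d v = 0 \<longleftrightarrow> l d v = 0" if d: "d \<in> D" and v: "v \<in> Uh" for d v
  proof -
    obtain \<mu> where \<mu>: "discrete_eigenpair a b c l Sh Uh \<mu> d"
      using D d by blast
    then have "A d v = \<mu> * l d v"
      using v by (simp add: discrete_eigenpair_iff)
    then show ?thesis
      using discrete_eigenvalue_pos [OF \<mu>] by simp
  qed
  have sym: "A x y = A y x" "l x y = l y x" for x y
    using symmetric_Ah l(2) by (simp_all add: symmetric_form_def)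
  have wV: "w \<in> V"
  proof -
    have "A w m = 0" if "m \<in> D \<union> K" for m
      using that w eig [of m w] sym [of w m] by (auto simp: K_def)
    then show ?thesis
      using w(1) null_on_M [OF A_bil] by (auto simp: V_def)
  qed
  have l_V_M: "l v m = 0" if "v \<in> V" "m \<in> M" for v m
  proof (rule null_on_M [OF l_bil _ that(2)])
    fix d assume d: "d \<in> D \<union> K"
    then have "A v d = 0"
      using that span_superset [of "D \<union> K"] by (auto simp: V_def M_def)
    then show "l v d = 0"
      using d that eig [of d v] sym [of v d] l_null_orthogonal [of d v] by (auto simp: K_def V_def)
  qed
  have V: "subspace V"
    using subspace_Uh unfolding V_def subspace_def
    by (auto simp: bilinear_lzero [OF A_bil] bilinear_ladd [OF A_bil] bilinear_lmul [OF A_bil])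
  \<comment> \<open>A vector of \<open>V\<close> with \<open>l v v = 0\<close> lies in
    \<open>K\<close>, hence is \<open>A\<close>-orthogonal to itself.\<close>
  have l_pos: "0 < l v v" if v: "v \<in> V" "v \<noteq> 0" for v
  proof (rule ccontr)
    assume "\<not> 0 < l v v"
    then have "v \<in> K"
      using l(3) [of v] v by (auto simp: K_def V_def)
    then have "v \<in> M"
      by (simp add: M_def span_base)
    then have "A v v = 0"
      using v by (auto simp: V_def)
    then show False
      using Ah_pos [of v] v by (auto simp: V_def)
  qed
  have "finite_dim_subspace V"
    using finite_dim_subspace_subset [OF V _ Uh] by (auto simp: V_def)
  moreover have "V \<noteq> {0}"
    using wV False by blast
  ultimately obtain v \<mu> where v: "v \<in> V" "v \<noteq> 0" "\<And>z. z \<in> V \<Longrightarrow> A v z = \<mu> * l v z"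
    and min: "\<And>z. z \<in> V \<Longrightarrow> \<mu> * l z z \<le> A z z"
    using rayleigh_minimizer [OF bounded_bilinear_Ah symmetric_Ah l(1,2) _ _ l_pos, of V] by blast
  have "finite_dim_subspace M"
    using finite_dim_subspace_subset [OF _ MU Uh] by (simp add: M_def)
  then obtain B where B: "finite B" "span B = M"
    by (auto simp: finite_dim_subspace_def)
  obtain C where C: "finite C" "span C = M" "orthonormal_for A C"
    using orthonormal_basis_for_form [OF A_bil symmetric_Ah B(1)] Ah_pos B MU
    by (metis subsetD)
  \<comment> \<open>So far the equation holds for test vectors in \<open>V\<close>. A general
    \<open>z\<close> differs from one by its \<open>A\<close>-projection \<open>p\<close> onto
    \<open>M\<close>, where both \<open>A v\<close> and \<open>l v\<close> vanish.\<close>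
  have eigen: "A v z = \<mu> * l v z" if z: "z \<in> Uh" for z
  proof -
    define p where "p = (\<Sum>e\<in>C. A z e *\<^sub>R e)"
    have pM: "p \<in> M"
      unfolding p_def C(2) [symmetric] by (intro span_sum span_scale span_base)
    have "A p m = A z m" if "m \<in> M" for m
      unfolding p_def using that C A_bil
      by (intro orthonormal_for_represents [OF A_bil C(1,3), of "A z"]) (auto simp: bilinear_def)
    then have "z - p \<in> V"
      using z pM MU subspace_Uh
      by (auto simp: V_def bilinear_lsub [OF A_bil] intro: subspace_diff)
    then have "A v (z - p) = \<mu> * l v (z - p)"
      by (rule v)
    moreover have "A v p = 0" "l v p = 0"
      using v(1) pM l_V_M by (auto simp: V_def)
    ultimately show ?thesis
      by (simp add: bilinear_rsub [OF A_bil] bilinear_rsub [OF l_bil])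
  qed
  \<comment> \<open>Otherwise the minimizer, scaled to \<open>l\<close>-norm 1, is an eigenvector
    covered by \<open>low\<close>. It then lies in \<open>M\<close> as well as in \<open>V\<close>,
    which contradicts definiteness of \<open>A\<close>.\<close>
  have "\<Lambda> \<le> \<mu>"
  proof (rule ccontr)
    assume "\<not> \<Lambda> \<le> \<mu>"
    define t where "t = 1 / sqrt (l v v)"
    have t: "t \<noteq> 0" "t * (t * l v v) = 1"
      using l_pos [OF v(1,2)] by (auto simp: t_def field_simps)
    have "discrete_eigenpair a b c l Sh Uh \<mu> (t *\<^sub>R v)"
      unfolding discrete_eigenpair_iff using t v(1) eigen subspace_Uh
      by (auto simp: V_def subspace_scale bilinear_lmul [OF A_bil] bilinear_lmul [OF l_bil]
          bilinear_rmul [OF l_bil])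
    then have "t *\<^sub>R v \<in> span D"
      using low \<open>\<not> \<Lambda> \<le> \<mu>\<close> by auto
    then have "(1 / t) *\<^sub>R (t *\<^sub>R v) \<in> span D"
      by (rule span_scale)
    then have "v \<in> M"
      using t span_mono [of D "D \<union> K"] by (auto simp: M_def)
    then have "A v v = 0"
      using v(1) by (auto simp: V_def)
    then show False
      using Ah_pos [of v] v by (auto simp: V_def)
  qed
  then have "\<Lambda> * l w w \<le> \<mu> * l w w"
    using l(3) by (rule mult_right_mono)
  also have "\<dots> \<le> A w w"
    using wV by (rule min)
  finally show ?thesis .
qed

text \<open>
  If \<open>v\<close> has the same \<open>b\<close>-moments as \<open>u\<close>, then \<open>gh v\<close> is the \<open>a\<close>-orthogonal projection of \<open>\<sigma>\<close>.
\<close>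
lemma Gh_energy_le:
  assumes \<sigma>: "\<And>\<tau>. a \<sigma> \<tau> = - b \<tau> u" and v: "\<And>\<tau>. \<tau> \<in> Sh \<Longrightarrow> b \<tau> (u - v) = 0"
  shows "a (gh v) (gh v) \<le> a \<sigma> \<sigma>"
proof -
  have "a (gh v) (gh v) = - b (gh v) v"
    by (rule Gh_eq [OF Gh_mem])
  also have "\<dots> = a \<sigma> (gh v)"
    using \<sigma> v [OF Gh_mem, of v] by (simp add: bilinear_rsub [OF b_bil])
  finally have "a (\<sigma> - gh v) (\<sigma> - gh v) = a \<sigma> \<sigma> - a (gh v) (gh v)"
    using a(2) by (simp add: symmetric_form_def bilinear_lsub [OF a_bil] bilinear_rsub [OF a_bil])
  then show ?thesis
    using a_nonneg [of "\<sigma> - gh v"] by simp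
qed

end

section \<open>Continuous eigenfunctions: the operator \<open>G\<close> and the energy on their
  span\<close>

lemma G_eqI:
  assumes j: "is_completion a j" and \<sigma>: "\<And>\<tau>. a \<sigma> \<tau> = - b \<tau> v"
  shows "G b j v = j \<sigma>"
  unfolding G_def
proof (rule the_equality)
  show "represents b j v (j \<sigma>)"
    using j \<sigma> by (simp add: represents_def is_completion_def)
next
  fix g assume g: "represents b j v g"
  \<comment> \<open>Two representatives differ by a vector orthogonal to the dense range of
    \<open>j\<close>, hence to itself.\<close>
  have "range j \<subseteq> {x. inner (g - j \<sigma>) x = 0}"
    using j \<sigma> g by (auto simp: represents_def is_completion_def inner_diff_left)
  then have "closure (range j) \<subseteq> {x. inner (g - j \<sigma>) x = 0}"
    by (rule closure_minimal) (rule closed_hyperplane)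
  moreover have "closure (range j) = UNIV"
    using j by (simp add: is_completion_def)
  ultimately have "g - j \<sigma> \<in> {x. inner (g - j \<sigma>) x = 0}"
    by (simp only: subset_iff UNIV_I simp_thms)
  then have "inner (g - j \<sigma>) (g - j \<sigma>) = 0"
    by (rule CollectD)
  then show "g = j \<sigma>"
    by simp
qed

text \<open>With \<open>\<sigma>\<close> the same combination of the stresses \<open>s k\<close>,
  testing the second equation of each eigenpair with \<open>w\<close> gives
  \<open>a \<sigma> \<sigma>\<close> as a sum of
  \<open>\<alpha> k * (lam k * l (u k) w - c (u k) w)\<close>. Orthonormality reduces
  \<open>l (u k) w\<close> to \<open>\<alpha> k\<close>, so no cross terms remain.\<close>

lemma eigenspan_energy:
  fixes a :: "'s::real_normed_vector \<Rightarrow> 's \<Rightarrow> real" and b :: "'s \<Rightarrow> 'u::real_normed_vector \<Rightarrow> real"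
    and \<alpha> lam :: "'k \<Rightarrow> real"
  assumes bil: "bilinear a" "bilinear b" "bilinear c" "bilinear l"
    and I: "finite I"
    and eig: "\<And>k. k \<in> I \<Longrightarrow> eigenpair a b c l (lam k) (u k)"
    and orth: "\<And>i k. i \<in> I \<Longrightarrow> k \<in> I \<Longrightarrow> l (u i) (u k) = (if i = k then 1 else 0)"
  defines "w \<equiv> \<Sum>k\<in>I. \<alpha> k *\<^sub>R u k"
  shows "\<exists>\<sigma>. (\<forall>\<tau>. a \<sigma> \<tau> = - b \<tau> w) \<and>
      a \<sigma> \<sigma> + c w w = (\<Sum>k\<in>I. lam k * (\<alpha> k)\<^sup>2)"
    and "l w w = (\<Sum>k\<in>I. (\<alpha> k)\<^sup>2)"
proof -
  have "\<exists>\<sigma>. eigen_equations a b c l UNIV UNIV (lam k) \<sigma> (u k)" if "k \<in> I" for k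
    using eig [OF that] by (simp add: eigenpair_def)
  then obtain s where s: "\<And>k. k \<in> I \<Longrightarrow> eigen_equations a b c l UNIV UNIV (lam k) (s k) (u k)"
    by metis
  have s1: "a (s k) \<tau> = - b \<tau> (u k)" if "k \<in> I" for k \<tau>
    using s [OF that] by (simp add: eigen_equations_def eq_neg_iff_add_eq_0)
  have s2: "- b (s k) v = lam k * l (u k) v - c (u k) v" if "k \<in> I" for k v
    using s [OF that] by (auto simp: eigen_equations_def algebra_simps)
  have l_uw: "l (u i) w = \<alpha> i" if "i \<in> I" for i
  proof -
    have "l (u i) w = (\<Sum>k\<in>I. if i = k then \<alpha> k else 0)"
      unfolding w_def bilinear_sum_scaleR_right [OF bil(4)]
      using orth that by (intro sum.cong) auto
    then show ?thesis
      using I that by simp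
  qed
  define \<sigma> where "\<sigma> = (\<Sum>k\<in>I. \<alpha> k *\<^sub>R s k)"
  have eq: "a \<sigma> \<tau> = - b \<tau> w" for \<tau>
    unfolding \<sigma>_def w_def bilinear_sum_scaleR_left [OF bil(1)] bilinear_sum_scaleR_right [OF bil(2)]
    using s1 by (simp add: sum_negf [symmetric])
  have "a \<sigma> \<sigma> = (\<Sum>k\<in>I. \<alpha> k * - b (s k) w)"
    unfolding eq by (subst \<sigma>_def) (simp add: bilinear_sum_scaleR_left [OF bil(2)] sum_negf)
  also have "\<dots> = (\<Sum>k\<in>I. lam k * (\<alpha> k)\<^sup>2 - \<alpha> k * c (u k) w)"
    using s2 l_uw by (intro sum.cong) (auto simp: algebra_simps power2_eq_square)
  also have "\<dots> = (\<Sum>k\<in>I. lam k * (\<alpha> k)\<^sup>2) - c w w"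
    by (simp add: sum_subtractf w_def bilinear_sum_scaleR_left [OF bil(3)])
  finally have "a \<sigma> \<sigma> + c w w = (\<Sum>k\<in>I. lam k * (\<alpha> k)\<^sup>2)"
    by simp
  then show "\<exists>\<sigma>. (\<forall>\<tau>. a \<sigma> \<tau> = - b \<tau> w) \<and>
      a \<sigma> \<sigma> + c w w = (\<Sum>k\<in>I. lam k * (\<alpha> k)\<^sup>2)"
    using eq by blast
  have "l w w = (\<Sum>k\<in>I. \<alpha> k * l (u k) w)"
    by (subst (1) w_def) (rule bilinear_sum_scaleR_left [OF bil(4)])
  then show "l w w = (\<Sum>k\<in>I. (\<alpha> k)\<^sup>2)"
    using l_uw by (simp add: power2_eq_square)
qed

theorem theorem3p4:
  fixes a :: "'s::{real_inner,complete_space} \<Rightarrow> 's \<Rightarrow> real"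
    and b :: "'s \<Rightarrow> 'u::{real_inner,complete_space} \<Rightarrow> real"
    and c l :: "'u \<Rightarrow> 'u \<Rightarrow> real"
    and j :: "'s \<Rightarrow> 'h::{real_inner,complete_space}"
    and Sh :: "'s set" and Uh :: "'u set"
    and Ph :: "'u \<Rightarrow> 'u"
    and J Nh :: nat and N :: enat
    and lam lamh :: "nat \<Rightarrow> real" and u :: "nat \<Rightarrow> 'u"
    and \<delta>h :: real
  assumes a: "bounded_bilinear a" "symmetric_form a" "\<forall>\<sigma>. \<sigma> \<noteq> 0 \<longrightarrow> 0 < a \<sigma> \<sigma>"
    and b: "bounded_bilinear b" "0 < inf_sup_const b UNIV UNIV"
    and completion: "is_completion a j"
    and U0_dense: "closure (U0 b j) = UNIV"
    and c: "bounded_bilinear c" "symmetric_form c" "\<forall>v. 0 \<le> c v v"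
    and l: "bounded_bilinear l" "symmetric_form l" "\<forall>v. 0 \<le> l v v"
    and compactness: "compact_solution_operator a b c l j"
    and Sh: "finite_dim_subspace Sh" and Uh: "finite_dim_subspace Uh"
    and discrete_inf_sup: "0 < inf_sup_const b Sh Uh"
    and l_nontrivial: "\<exists>vh\<in>Uh. 0 < l vh vh"
    and kernels: "form_kernel b Sh Uh \<subseteq> form_kernel b UNIV UNIV"
    and Ph: "linear Ph" "\<forall>v. Ph v \<in> Uh" "\<forall>vh\<in>Uh. Ph vh = vh"
      "\<forall>\<tau>h\<in>Sh. \<forall>v. b \<tau>h (v - Ph v) = 0"
    and J: "1 \<le> J"
    and discrete_eigenvalues:
      "enumerates_eigenvalues (discrete_eigenpair a b c l Sh Uh) (enat Nh) lamh" "J \<le> Nh"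
    and eigenvalues: "enumerates_eigenvalues (eigenpair a b c l) N lam" "enat J \<le> N"
    and eigenfunctions: "\<forall>k\<in>{1..J}. eigenpair a b c l (lam k) (u k)"
    and orthonormal: "\<forall>i\<in>{1..J}. \<forall>k\<in>{1..J}. l (u i) (u k) = (if i = k then 1 else 0)"
    and approximation: "\<forall>w\<in>span (u ` {1..J}).
      (form_norm l (w - Ph w))\<^sup>2 \<le> \<delta>h\<^sup>2 * ((norm (G b j w))\<^sup>2 + (form_norm c w)\<^sup>2)"
    and i: "\<forall>w\<in>span (u ` {1..J}).
      (form_norm l (Ph w))\<^sup>2 + (form_norm l (w - Ph w))\<^sup>2 = (form_norm l w)\<^sup>2"
    and ii: "\<forall>w\<in>span (u ` {1..J}). (form_norm c (Ph w))\<^sup>2 \<le> (form_norm c w)\<^sup>2"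
    and iii: "\<forall>w\<in>span (u ` {1..J}). \<forall>wh\<in>Uh. l wh wh = 0 \<longrightarrow> Ah a b c Sh (Ph w) wh = 0"
  shows "lamh J / (1 + \<delta>h\<^sup>2 * lamh J) \<le> lam J"
proof -
  interpret discrete_problem a b c l Sh Uh
    using a b(1) c l Sh Uh discrete_inf_sup by (intro discrete_problem.intro) blast+
  define w where "w \<alpha> = (\<Sum>k\<in>{1..J}. \<alpha> k *\<^sub>R u k)" for \<alpha> :: "nat \<Rightarrow> real"
  have w_span: "w \<alpha> \<in> span (u ` {1..J})" for \<alpha>
    unfolding w_def by (intro span_sum span_scale span_base) auto
  have ex_energy: "\<exists>\<sigma>. (\<forall>\<tau>. a \<sigma> \<tau> = - b \<tau> (w \<alpha>)) \<and>
      a \<sigma> \<sigma> + c (w \<alpha>) (w \<alpha>) = (\<Sum>k\<in>{1..J}. lam k * (\<alpha> k)\<^sup>2)"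
    and l_w: "l (w \<alpha>) (w \<alpha>) = (\<Sum>k\<in>{1..J}. (\<alpha> k)\<^sup>2)" for \<alpha>
    unfolding w_def using eigenfunctions orthonormal
    by (intro eigenspan_energy [OF a_bil b_bil c_bil l_bil, where lam = lam and u = u]; blast)+
  have lamh_pos: "0 < lamh J"
    by (rule enumerates_eigenvalues_eigenvector [OF discrete_eigenvalues(1) J])
      (use discrete_eigenvalues(2) discrete_eigenvalue_pos in auto)
  \<comment> \<open>The coefficients \<open>indicator {J}\<close> select \<open>u J\<close>, whose
    energy is exactly \<open>lam J\<close>.\<close>
  have lam_nonneg: "0 \<le> lam J"
  proof -
    obtain \<sigma> where "a \<sigma> \<sigma> + c (w (indicator {J})) (w (indicator {J})) =
        (\<Sum>k\<in>{1..J}. lam k * (indicator {J} k)\<^sup>2)"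
      using ex_energy by blast
    also have "\<dots> = (\<Sum>k\<in>{1..J}. if k = J then lam k else 0)"
      by (intro sum.cong) auto
    also have "\<dots> = lam J"
      using J by simp
    finally show ?thesis
      using a_nonneg [of \<sigma>] c(3) [rule_format, of "w (indicator {J})"] by simp
  qed
  have den_pos: "0 < 1 + \<delta>h\<^sup>2 * lamh J"
    using lamh_pos by (simp add: add_pos_nonneg)
  have "lamh J \<le> lam J * (1 + \<delta>h\<^sup>2 * lamh J)"
  proof (cases "\<delta>h\<^sup>2 * lam J < 1")
    case False
    \<comment> \<open>Here the term \<open>\<delta>h\<^sup>2 * lam J * lamh J\<close> alone
      dominates \<open>lamh J\<close>.\<close>
    then have "1 * lamh J \<le> (\<delta>h\<^sup>2 * lam J) * lamh J"
      using lamh_pos by (intro mult_right_mono) auto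
    then show ?thesis
      using lam_nonneg by (simp add: algebra_simps)
  next
    case True
    have nonzero: "v \<noteq> 0" if "discrete_eigenpair a b c l Sh Uh \<mu> v" for \<mu> v
      using that bilinear_lzero [OF l_bil] by (auto simp: discrete_eigenpair_iff)
    obtain D where D: "finite D" "card D < J"
      "\<And>d. d \<in> D \<Longrightarrow> \<exists>\<mu>. discrete_eigenpair a b c l Sh Uh \<mu> d"
      "\<And>\<mu> v. discrete_eigenpair a b c l Sh Uh \<mu> v \<Longrightarrow> \<mu> < lamh J \<Longrightarrow> v \<in> span D"
      by (rule enumerates_eigenvalues_lower_span [OF discrete_eigenvalues(1) J _ nonzero])
        (use discrete_eigenvalues(2) in auto)
    \<comment> \<open>\<open>J\<close> unknown coefficients face fewer than \<open>J\<close>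
      equations, which say that \<open>Ph x\<close> is \<open>l\<close>-orthogonal to
      \<open>D\<close>.\<close>
    obtain \<alpha> where \<alpha>: "\<exists>k\<in>{1..J}. \<alpha> k \<noteq> 0"
      "\<forall>d\<in>D. (\<Sum>k\<in>{1..J}. \<alpha> k * l (Ph (u k)) d) = 0"
      using homogeneous_system_nontrivial [OF D(1), of "{1..J}" "\<lambda>d k. l (Ph (u k)) d"] D(2)
      by auto
    define x where "x = w \<alpha>"
    define X where "X = (\<Sum>k\<in>{1..J}. (\<alpha> k)\<^sup>2)"
    obtain \<sigma> where \<sigma>: "\<And>\<tau>. a \<sigma> \<tau> = - b \<tau> x"
      "a \<sigma> \<sigma> + c x x = (\<Sum>k\<in>{1..J}. lam k * (\<alpha> k)\<^sup>2)"
      using ex_energy [of \<alpha>] unfolding x_def by blast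
    have lx: "l x x = X"
      unfolding x_def X_def by (rule l_w)
    have "0 < X"
      unfolding X_def using \<alpha>(1) by (auto intro: sum_pos2)
    have "a \<sigma> \<sigma> + c x x \<le> (\<Sum>k\<in>{1..J}. lam J * (\<alpha> k)\<^sup>2)"
      unfolding \<sigma>(2) using enumerates_eigenvalues_mono [OF eigenvalues(1) _ _ eigenvalues(2)]
      by (intro sum_mono mult_right_mono) auto
    then have energy_le: "a \<sigma> \<sigma> + c x x \<le> lam J * X"
      by (simp add: X_def sum_distrib_left)
    have span: "x \<in> span (u ` {1..J})"
      unfolding x_def by (rule w_span)
    \<comment> \<open>The stress of a combination of eigenfunctions lies in the original space, so
      the norm of \<open>G b j x\<close> in the completion is given by
      \<open>a \<sigma> \<sigma>\<close>.\<close>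
    have "G b j x = j \<sigma>"
      using completion \<sigma>(1) by (rule G_eqI)
    then have normG: "(norm (G b j x))\<^sup>2 = a \<sigma> \<sigma>"
      using completion by (simp add: is_completion_def power2_norm_eq_inner)
    have "l (x - Ph x) (x - Ph x) \<le> \<delta>h\<^sup>2 * (a \<sigma> \<sigma> + c x x)"
      using bspec [OF approximation span] l(3) c(3) by (simp add: form_norm_power2 normG)
    also have "\<dots> \<le> \<delta>h\<^sup>2 * (lam J * X)"
      using energy_le by (rule mult_left_mono) simp
    \<comment> \<open>By (i), the \<open>l\<close>-norm lost under \<open>Ph\<close> is exactly that
      of \<open>x - Ph x\<close>.\<close>
    finally have "X - \<delta>h\<^sup>2 * (lam J * X) \<le> l (Ph x) (Ph x)"
      using bspec [OF i span] l(3) \<open>0 < X\<close> by (simp add: form_norm_power2 lx)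
    then have lP: "(1 - \<delta>h\<^sup>2 * lam J) * X \<le> l (Ph x) (Ph x)"
      by (simp add: algebra_simps)
    have "a (gh (Ph x)) (gh (Ph x)) \<le> a \<sigma> \<sigma>"
      using Gh_energy_le [OF \<sigma>(1)] Ph(4) by blast
    moreover have "c (Ph x) (Ph x) \<le> c x x"
      using bspec [OF ii span] c(3) by (simp add: form_norm_power2)
    ultimately have AP: "A (Ph x) (Ph x) \<le> lam J * X"
      using energy_le by (simp add: Ah_def)
    have "Ph x = (\<Sum>k\<in>{1..J}. \<alpha> k *\<^sub>R Ph (u k))"
      unfolding x_def w_def by (simp add: linear_sum [OF Ph(1)] linear_scale [OF Ph(1)])
    then have "l (Ph x) d = 0" if "d \<in> D" for d
      using \<alpha>(2) that by (simp add: bilinear_sum_scaleR_left [OF l_bil])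
    \<comment> \<open>Condition (iii) supplies the \<open>A\<close>-orthogonality to the null
      vectors of \<open>l\<close>.\<close>
    then have "lamh J * l (Ph x) (Ph x) \<le> A (Ph x) (Ph x)"
      using Ph(2) iii span by (intro discrete_rayleigh_lower_bound [OF D(3,4)]) auto
    with AP have "lamh J * l (Ph x) (Ph x) \<le> lam J * X"
      by simp
    moreover have "lamh J * ((1 - \<delta>h\<^sup>2 * lam J) * X) \<le> lamh J * l (Ph x) (Ph x)"
      using lP lamh_pos by (intro mult_left_mono) auto
    ultimately have "(lamh J * (1 - \<delta>h\<^sup>2 * lam J)) * X \<le> lam J * X"
      by (simp add: mult.assoc)
    \<comment> \<open>A nonzero coefficient makes \<open>X\<close> positive, so it cancels; what
      remains is the claim cleared of its denominator.\<close>
    then have "lamh J * (1 - \<delta>h\<^sup>2 * lam J) \<le> lam J"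
      using \<open>0 < X\<close> by simp
    then show ?thesis
      by (simp add: algebra_simps)
  qed
  then show ?thesis
    using den_pos by (simp add: pos_divide_le_eq)
qed

end
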